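(* Let $f(z_1,z_2)=\sum_{k=0}^{K}a_k(z_1z_2)^k$ be a polynomial in $z_1z_2$ that is not identically zero, and let $\mathcal{H}$ be a reproducing kernel Hilbert space in two variables in which the monomials are pairwise orthogonal. Let $\{\varphi_k\}_{k\ge0}$ be the monic orthogonal polynomials for the weighted space $\mathcal{H}_f$ with respect to degree lexicographic order. For each integer $N\ge0$, let $$M=\max\{\deg_{z_1}\varphi_N,\deg_{z_2}\varphi_N\}-\min\{\deg_{z_1}\varphi_N,\deg_{z_2}\varphi_N\}.$$ Then there exists a unique $r_N\in\mathbb{C}[x]$ such that (1) if $\deg_{z_1}\varphi_N\ge\deg_{z_2}\varphi_N$, then $\varphi_N(z_1,z_2)=z_1^M\,r_N(z_1z_2)$; (2) if $\deg_{z_1}\varphi_N\le\deg_{z_2}\varphi_N$, then $\varphi_N(z_1,z_2)=z_2^M\,r_N(z_1z_2)$.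
   Context: $\mathcal{H}=\mathcal{H}(\Omega)$ is a reproducing kernel Hilbert space of holomorphic functions on an open set $\Omega\subset\mathbb{C}^2$ containing the origin. Standing assumptions: the polynomial ring $\mathbb{C}[z_1,z_2]$ is a dense subspace of $\mathcal{H}$, multiplication by each coordinate function $z_1,z_2$ is a bounded operator on $\mathcal{H}$. The weighted space $\mathcal{H}_f$ carries the inner product $\langle g,h\rangle_{\mathcal{H}_f}=\langle gf,hf\rangle_{\mathcal{H}}$. The monomials are listed in degree lexicographic order, i.e. by increasing total degree with ties broken lexicographically: $\chi_0=1,\ \chi_1=z_1,\ \chi_2=z_2,\ \chi_3=z_1^2,\ \chi_4=z_1z_2,\ \chi_5=z_2^2,\ \chi_6=z_1^3,\dots$, and $\mathcal{P}_n=\mathrm{span}\{\chi_0,\dots,\chi_n\}$. The orthogonal polynomials $\{\varphi_k\}$ for $\mathcal{H}_f$ are pairwise orthogonal in $\mathcal{H}_f$, are ordered so that $\mathrm{span}\{\varphi_0,\dots,\varphi_n\}=\mathcal{P}_n$ for every $n$, satisfy $\deg_{z_1}\varphi_k=\deg_{z_1}\chi_k$ and $\deg_{z_2}\varphi_k=\deg_{z_2}\chi_k$, and each $\varphi_k$ is monic (the coefficient of $\chi_k$ in $\varphi_k$ is $1$). Here $\deg_{z_j}p$ denotes the degree of $p$ in the variable $z_j$. *)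

theory Defs
  imports
    "HOL-Analysis.Analysis"
    "HOL-Computational_Algebra.Polynomial"
    "HOL-Library.Nat_Bijection"
begin

section \<open>Polynomials in two variables\<close>

text \<open>
  The ring C[z1, z2] is represented by the type \<open>complex poly poly\<close>: the outer variable
  is \<open>z1\<close> and the inner one is \<open>z2\<close>.  Hence the coefficient of \<open>z1 ^ i * z2 ^ j\<close> in \<open>p\<close> is
  \<open>coeff (coeff p i) j\<close>, and the scalar action of \<open>c\<close> is \<open>smult [:c:]\<close>.
\<close>

definition Z1 :: "complex poly poly" where
  "Z1 = [:0, 1:]"

definition Z2 :: "complex poly poly" where
  "Z2 = [:[:0, 1:]:]"

definition eval2 :: "complex poly poly \<Rightarrow> complex \<Rightarrow> complex \<Rightarrow> complex" where
  "eval2 p z1 z2 = poly (poly p [:z1:]) z2"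

definition deg1 :: "complex poly poly \<Rightarrow> nat" where
  "deg1 p = degree p"

definition deg2 :: "complex poly poly \<Rightarrow> nat" where
  "deg2 p = (MAX i\<in>{..degree p}. degree (coeff p i))"

lemma eval2_Z1: "eval2 Z1 z1 z2 = z1" and eval2_Z2: "eval2 Z2 z1 z2 = z2"
  by (simp_all add: eval2_def Z1_def Z2_def)

global_interpretation poly2: vector_space "\<lambda>(c::complex) (p::complex poly poly). smult [:c:] p"
  by unfold_locales
    (simp_all add: smult_add_right mult.commute flip: smult_add_left one_pCons)


section \<open>Degree lexicographic order\<close>

text \<open>
  The pairing function behind \<open>prod_decode\<close> runs through the antidiagonals of
  \<open>nat \<times> nat\<close> by increasing first component.  Reading the first component as the
  exponent of \<open>z2\<close> and the second one as the exponent of \<open>z1\<close> lists the monomials as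
  \<open>1, z1, z2, z1^2, z1 z2, z2^2, z1^3, \<dots>\<close>.
\<close>

definition exp1 :: "nat \<Rightarrow> nat" where
  "exp1 k = snd (prod_decode k)"

definition exp2 :: "nat \<Rightarrow> nat" where
  "exp2 k = fst (prod_decode k)"

definition chi :: "nat \<Rightarrow> complex poly poly" where
  "chi k = Z1 ^ exp1 k * Z2 ^ exp2 k"

text \<open>The list contains every monomial exactly once and is increasing for the degree
  lexicographic order with \<open>z1\<close> before \<open>z2\<close>.\<close>

lemma bij_exps: "bij (\<lambda>k. (exp1 k, exp2 k))"
proof -
  have "(\<lambda>k. (exp1 k, exp2 k)) = prod.swap \<circ> prod_decode"
    by (auto simp: exp1_def exp2_def fun_eq_iff prod.swap_def)
  then show ?thesis
    using bij_comp[OF bij_prod_decode bij_swap] by simp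
qed

lemma triangle_mono: "m \<le> n \<Longrightarrow> triangle m \<le> triangle n"
  by (induction rule: dec_induct) auto

lemma exps_deglex:
  assumes "k < l"
  shows "exp1 k + exp2 k < exp1 l + exp2 l \<or>
         exp1 k + exp2 k = exp1 l + exp2 l \<and> exp1 k > exp1 l"
proof -
  have enc: "n = triangle (exp2 n + exp1 n) + exp2 n" for n
    using prod_decode_inverse[of n] by (simp add: exp1_def exp2_def prod_encode_def split_beta)
  have "exp2 k + exp1 k \<le> exp2 l + exp1 l"
  proof (rule ccontr)
    assume "\<not> ?thesis"
    then have "triangle (Suc (exp2 l + exp1 l)) \<le> triangle (exp2 k + exp1 k)"
      by (intro triangle_mono) simp
    then show False
      using enc[of k] enc[of l] assms by simp
  qed
  moreover have "exp2 k < exp2 l" if "exp2 k + exp1 k = exp2 l + exp1 l"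
    using enc[of k] enc[of l] assms that by simp
  ultimately show ?thesis
    by (cases "exp2 k + exp1 k = exp2 l + exp1 l") auto
qed


section \<open>Hilbert spaces of holomorphic functions in two variables\<close>

definition holomorphic2_on :: "(complex \<times> complex \<Rightarrow> complex) \<Rightarrow> (complex \<times> complex) set \<Rightarrow> bool"
  where "holomorphic2_on g \<Omega> \<longleftrightarrow>
    (\<forall>z\<in>\<Omega>. \<exists>a b. (g has_derivative (\<lambda>h. a * fst h + b * snd h)) (at z))"

text \<open>A function on \<open>\<Omega>\<close> is represented by its extension by zero, so that the functions on
  \<open>\<Omega>\<close> form a vector space under the pointwise operations and are equal iff they agree on
  \<open>\<Omega>\<close>.\<close>

definition pfun :: "(complex \<times> complex) set \<Rightarrow> complex poly poly \<Rightarrow> complex \<times> complex \<Rightarrow> complex"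
  where "pfun \<Omega> p = (\<lambda>z. if z \<in> \<Omega> then eval2 p (fst z) (snd z) else 0)"

definition ip_norm ::
  "((complex \<times> complex \<Rightarrow> complex) \<Rightarrow> (complex \<times> complex \<Rightarrow> complex) \<Rightarrow> complex) \<Rightarrow>
   (complex \<times> complex \<Rightarrow> complex) \<Rightarrow> real"
  where "ip_norm ip g = sqrt (Re (ip g g))"

locale function_hilbert_space =
  fixes \<Omega> :: "(complex \<times> complex) set"
    and H :: "(complex \<times> complex \<Rightarrow> complex) set"
    and ip :: "(complex \<times> complex \<Rightarrow> complex) \<Rightarrow> (complex \<times> complex \<Rightarrow> complex) \<Rightarrow> complex"
  assumes zero_outside: "g \<in> H \<Longrightarrow> z \<notin> \<Omega> \<Longrightarrow> g z = 0"
    and zero_mem: "(\<lambda>z. 0) \<in> H"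
    and add_mem: "g \<in> H \<Longrightarrow> h \<in> H \<Longrightarrow> (\<lambda>z. g z + h z) \<in> H"
    and scale_mem: "g \<in> H \<Longrightarrow> (\<lambda>z. c * g z) \<in> H"
    and ip_cnj: "g \<in> H \<Longrightarrow> h \<in> H \<Longrightarrow> ip h g = cnj (ip g h)"
    and ip_add: "g \<in> H \<Longrightarrow> g' \<in> H \<Longrightarrow> h \<in> H \<Longrightarrow> ip (\<lambda>z. g z + g' z) h = ip g h + ip g' h"
    and ip_scale: "g \<in> H \<Longrightarrow> h \<in> H \<Longrightarrow> ip (\<lambda>z. c * g z) h = c * ip g h"
    and ip_nonneg: "g \<in> H \<Longrightarrow> 0 \<le> Re (ip g g)"
    and ip_definite: "g \<in> H \<Longrightarrow> ip g g = 0 \<Longrightarrow> g = (\<lambda>z. 0)"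
    and complete:
      "(\<And>n. s n \<in> H) \<Longrightarrow>
       (\<And>e. 0 < e \<Longrightarrow> \<exists>n0. \<forall>m\<ge>n0. \<forall>n\<ge>n0. ip_norm ip (\<lambda>z. s m z - s n z) < e) \<Longrightarrow>
       \<exists>g\<in>H. (\<lambda>n. ip_norm ip (\<lambda>z. s n z - g z)) \<longlonglongrightarrow> 0"

locale holomorphic_rkhs = function_hilbert_space +
  assumes open_domain: "open \<Omega>"
    and origin_in_domain: "(0, 0) \<in> \<Omega>"
    and holomorphic: "g \<in> H \<Longrightarrow> holomorphic2_on g \<Omega>"
    and evaluation_bounded: "z \<in> \<Omega> \<Longrightarrow> \<exists>C. \<forall>g\<in>H. cmod (g z) \<le> C * ip_norm ip g"
    and polynomials_mem: "pfun \<Omega> p \<in> H"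
    and polynomials_dense: "g \<in> H \<Longrightarrow> 0 < e \<Longrightarrow> \<exists>p. ip_norm ip (\<lambda>z. g z - pfun \<Omega> p z) < e"
    and mult_z1_mem: "g \<in> H \<Longrightarrow> (\<lambda>z. fst z * g z) \<in> H"
    and mult_z2_mem: "g \<in> H \<Longrightarrow> (\<lambda>z. snd z * g z) \<in> H"
    and mult_z1_bounded: "\<exists>C. \<forall>g\<in>H. ip_norm ip (\<lambda>z. fst z * g z) \<le> C * ip_norm ip g"
    and mult_z2_bounded: "\<exists>C. \<forall>g\<in>H. ip_norm ip (\<lambda>z. snd z * g z) \<le> C * ip_norm ip g"

definition weighted_ip ::
  "((complex \<times> complex \<Rightarrow> complex) \<Rightarrow> (complex \<times> complex \<Rightarrow> complex) \<Rightarrow> complex) \<Rightarrow>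
   (complex \<times> complex \<Rightarrow> complex) \<Rightarrow>
   (complex \<times> complex \<Rightarrow> complex) \<Rightarrow> (complex \<times> complex \<Rightarrow> complex) \<Rightarrow> complex"
  where "weighted_ip ip f g h = ip (\<lambda>z. g z * f z) (\<lambda>z. h z * f z)"

definition monomials_orthogonal ::
  "(complex \<times> complex) set \<Rightarrow>
   ((complex \<times> complex \<Rightarrow> complex) \<Rightarrow> (complex \<times> complex \<Rightarrow> complex) \<Rightarrow> complex) \<Rightarrow> bool"
  where "monomials_orthogonal \<Omega> ip \<longleftrightarrow>
    (\<forall>i j i' j'. (i, j) \<noteq> (i', j') \<longrightarrow>
       ip (pfun \<Omega> (Z1 ^ i * Z2 ^ j)) (pfun \<Omega> (Z1 ^ i' * Z2 ^ j')) = 0)"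

definition monic_orthogonal_polys ::
  "(complex \<times> complex) set \<Rightarrow>
   ((complex \<times> complex \<Rightarrow> complex) \<Rightarrow> (complex \<times> complex \<Rightarrow> complex) \<Rightarrow> complex) \<Rightarrow>
   complex poly poly \<Rightarrow> (nat \<Rightarrow> complex poly poly) \<Rightarrow> bool"
  where "monic_orthogonal_polys \<Omega> ip f \<phi> \<longleftrightarrow>
    (\<forall>k l. k \<noteq> l \<longrightarrow> weighted_ip ip (pfun \<Omega> f) (pfun \<Omega> (\<phi> k)) (pfun \<Omega> (\<phi> l)) = 0) \<and>
    (\<forall>n. poly2.span (\<phi> ` {..n}) = poly2.span (chi ` {..n})) \<and>
    (\<forall>k. deg1 (\<phi> k) = deg1 (chi k) \<and> deg2 (\<phi> k) = deg2 (chi k)) \<and>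
    (\<forall>k. coeff (coeff (\<phi> k) (exp1 k)) (exp2 k) = 1)"

end

theory Submission
  imports Defs
begin

text \<open>
  Give the monomial \<open>z1 ^ i * z2 ^ j\<close> the weight \<open>i - j\<close>.  A polynomial in \<open>z1 * z2\<close> is a
  combination of monomials of weight \<open>0\<close>, so multiplication by \<open>f\<close> preserves weights, and as
  distinct monomials are orthogonal in the Hilbert space, polynomials whose weights are
  disjoint are orthogonal also in the weighted space (\<open>weighted_ip_of_weight_disjoint\<close>).

  Let \<open>d\<close> be the weight of \<open>chi N\<close>, and write \<open>\<phi> N = g + h\<close> where \<open>g\<close> collects the terms of
  weight \<open>d\<close>.  The leading monomial \<open>chi N\<close> occurs in \<open>g\<close> only, so \<open>h\<close> lies in the span of the
  earlier monomials, which is the span of the earlier orthogonal polynomials; hence \<open>h\<close> is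
  orthogonal to \<open>\<phi> N\<close>.  It is also orthogonal to \<open>g\<close>, and therefore to itself.  So \<open>h * f\<close>
  vanishes on a neighbourhood of the origin, and \<open>h = 0\<close> because \<open>f\<close> is not zero.

  Thus \<open>\<phi> N\<close> has only terms \<open>z1 ^ i * z2 ^ j\<close> with \<open>i - j = d\<close>.  Its partial degrees are the
  exponents of \<open>chi N\<close>, so \<open>M\<close> is the absolute value of \<open>d\<close>, and every term is
  \<open>z1 ^ M\<close> or \<open>z2 ^ M\<close>, according to the sign of \<open>d\<close>, times a power of \<open>z1 * z2\<close>.  The
  polynomial \<open>r\<close> is recovered by setting the first or the second variable equal to \<open>1\<close>.
\<close>

section \<open>Evaluation and degrees of bivariate polynomials\<close>

lemma eval2_simps [simp]:
  "eval2 0 x y = 0"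
  "eval2 (p + q) x y = eval2 p x y + eval2 q x y"
  "eval2 (p * q) x y = eval2 p x y * eval2 q x y"
  "eval2 (smult [:c:] p) x y = c * eval2 p x y"
  "eval2 (p ^ n) x y = eval2 p x y ^ n"
  by (simp_all add: eval2_def)

lemma pfun_simps:
  "pfun \<Omega> 0 = (\<lambda>z. 0)"
  "pfun \<Omega> (p + q) = (\<lambda>z. pfun \<Omega> p z + pfun \<Omega> q z)"
  "pfun \<Omega> (p * q) = (\<lambda>z. pfun \<Omega> p z * pfun \<Omega> q z)"
  "pfun \<Omega> (smult [:c:] p) = (\<lambda>z. c * pfun \<Omega> p z)"
  by (auto simp: pfun_def)

text \<open>A bivariate polynomial is a univariate one over an integral domain, so finiteness of
  the root set applies twice: first to the inner, then to the outer variable.\<close>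

lemma eval2_eq_0_imp_eq_0:
  assumes "infinite A" "infinite B"
    and vanish: "\<And>x y. x \<in> A \<Longrightarrow> y \<in> B \<Longrightarrow> eval2 p x y = 0"
  shows "p = 0"
proof (rule ccontr)
  assume "p \<noteq> 0"
  have "poly p [:x:] = 0" if "x \<in> A" for x
  proof (rule ccontr)
    assume "poly p [:x:] \<noteq> 0"
    moreover have "B \<subseteq> {y. poly (poly p [:x:]) y = 0}"
      using vanish that by (auto simp: eval2_def)
    ultimately show False
      using poly_roots_finite finite_subset \<open>infinite B\<close> by blast
  qed
  then have "(\<lambda>x. [:x:]) ` A \<subseteq> {c. poly p c = 0}"
    by auto
  then have "finite ((\<lambda>x. [:x:]) ` A)"
    using poly_roots_finite[OF \<open>p \<noteq> 0\<close>] by (rule finite_subset)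
  then have "finite A"
    by (rule finite_imageD) (simp add: inj_on_def)
  then show False
    using \<open>infinite A\<close> by simp
qed

lemma pfun_eq_0_imp_eq_0:
  assumes "open \<Omega>" "\<Omega> \<noteq> {}" "pfun \<Omega> p = (\<lambda>z. 0)"
  shows "p = 0"
proof -
  obtain u v where "(u, v) \<in> \<Omega>"
    using \<open>\<Omega> \<noteq> {}\<close> by auto
  then obtain A B where AB: "open A" "open B" "u \<in> A" "v \<in> B" "A \<times> B \<subseteq> \<Omega>"
    using \<open>open \<Omega>\<close> by (auto elim!: open_prod_elim)
  have "eval2 p x y = 0" if "x \<in> A" "y \<in> B" for x y
    using fun_cong[OF assms(3), of "(x, y)"] AB(5) that by (auto simp: pfun_def)
  moreover have "infinite A" "infinite B"
    using AB by (auto dest: finite_imp_not_open)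
  ultimately show ?thesis
    using eval2_eq_0_imp_eq_0 by blast
qed

lemma chi_eq_monom: "chi k = monom (monom 1 (exp2 k)) (exp1 k)"
proof -
  have "Z1 ^ i = monom 1 i" for i
    by (induction i) (simp_all add: Z1_def monom_altdef)
  moreover have "Z2 ^ j = [:monom 1 j:]" for j
    by (induction j) (simp_all add: Z2_def monom_altdef mult.commute flip: one_pCons)
  ultimately show ?thesis
    by (simp add: chi_def smult_monom)
qed

lemma deg1_chi: "deg1 (chi k) = exp1 k"
  by (simp add: deg1_def chi_eq_monom degree_monom_eq)

lemma deg2_chi: "deg2 (chi k) = exp2 k"
proof -
  have deg: "degree (chi k) = exp1 k"
    using deg1_chi by (simp add: deg1_def)
  show ?thesis
    unfolding deg2_def deg
    by (intro Max_eqI) (auto simp: chi_eq_monom degree_monom_eq intro!: rev_image_eqI[of "exp1 k"])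
qed


section \<open>The weight grading\<close>

text \<open>Sets of weights rather than single weights are allowed, so that the complement of a
  homogeneous component is covered as well.\<close>

definition weight_space :: "int set \<Rightarrow> complex poly poly set" where
  "weight_space D = poly2.span {Z1 ^ i * Z2 ^ j | i j. int i - int j \<in> D}"

lemma chi_in_weight_space: "int (exp1 k) - int (exp2 k) \<in> D \<Longrightarrow> chi k \<in> weight_space D"
  unfolding weight_space_def chi_def by (intro poly2.span_base) blast

lemma mult_Z1_Z2_weight_space:
  assumes "p \<in> weight_space D"
  shows "(Z1 * Z2) ^ k * p \<in> weight_space D"
  using assms unfolding weight_space_def
proof (induction p rule: poly2.span_induct_alt)
  case base
  show ?case
    by (simp add: poly2.span_zero)
next
  case (step c p q)
  then obtain i j where p: "p = Z1 ^ i * Z2 ^ j" and ij: "int i - int j \<in> D"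
    by blast
  have "(Z1 * Z2) ^ k * p = Z1 ^ (i + k) * Z2 ^ (j + k)"
    by (simp add: p power_add power_mult_distrib mult_ac)
  moreover have "int (i + k) - int (j + k) \<in> D"
    using ij by simp
  ultimately have "(Z1 * Z2) ^ k * p \<in> poly2.span {Z1 ^ i * Z2 ^ j | i j. int i - int j \<in> D}"
    by (intro poly2.span_base) blast
  then show ?case
    using step.IH by (simp add: distrib_left poly2.span_add poly2.span_scale)
qed

lemma mult_poly_in_Z1_Z2_weight_space:
  assumes "p \<in> weight_space D"
  shows "p * (\<Sum>k\<in>I. smult [:a k:] ((Z1 * Z2) ^ k)) \<in> weight_space D"
proof -
  have "(\<Sum>k\<in>I. smult [:a k:] ((Z1 * Z2) ^ k * p)) \<in> weight_space D"
    using mult_Z1_Z2_weight_space[OF assms] unfolding weight_space_def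
    by (intro poly2.span_sum poly2.span_scale)
  also have "(\<Sum>k\<in>I. smult [:a k:] ((Z1 * Z2) ^ k * p))
      = p * (\<Sum>k\<in>I. smult [:a k:] ((Z1 * Z2) ^ k))"
    by (simp add: sum_distrib_left mult.commute)
  finally show ?thesis .
qed

text \<open>Splitting off the terms that have the weight of \<open>chi N\<close> removes \<open>chi N\<close> itself from
  the remainder, which is why the remainder has lower order.\<close>

lemma split_leading_weight:
  assumes "p \<in> poly2.span (chi ` {..N})"
    and d: "d = int (exp1 N) - int (exp2 N)"
  obtains g h where "p = g + h" "g \<in> weight_space {d}" "h \<in> weight_space (- {d})"
    "h \<in> poly2.span (chi ` {..<N})"
proof -
  have "\<exists>g h. p = g + h \<and> g \<in> weight_space {d} \<and> h \<in> weight_space (- {d}) \<and>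
      h \<in> poly2.span (chi ` {..<N})"
    using assms(1)
  proof (induction p rule: poly2.span_induct_alt)
    case base
    show ?case
      by (intro exI[of _ 0]) (simp add: weight_space_def poly2.span_zero)
  next
    case (step c q p)
    then obtain k where k: "q = chi k" "k \<le> N"
      by auto
    obtain g h where gh: "p = g + h" "g \<in> weight_space {d}" "h \<in> weight_space (- {d})"
      "h \<in> poly2.span (chi ` {..<N})"
      using step.IH by blast
    show ?case
    proof (cases "int (exp1 k) - int (exp2 k) = d")
      case True
      then have "smult [:c:] q + g \<in> weight_space {d}"
        using gh(2) chi_in_weight_space[of k "{d}"] unfolding k weight_space_def
        by (intro poly2.span_add poly2.span_scale) auto
      then show ?thesis
        using gh by (intro exI[of _ "smult [:c:] q + g"] exI[of _ h]) simp
    next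
      case False
      then have "k < N"
        using k d by (cases "k = N") auto
      then have "smult [:c:] q + h \<in> poly2.span (chi ` {..<N})"
        using gh(4) unfolding k
        by (intro poly2.span_add poly2.span_scale) (auto intro: poly2.span_base)
      moreover have "smult [:c:] q + h \<in> weight_space (- {d})"
        using gh(3) False chi_in_weight_space[of k "- {d}"] unfolding k weight_space_def
        by (intro poly2.span_add poly2.span_scale) auto
      ultimately show ?thesis
        using gh by (intro exI[of _ g] exI[of _ "smult [:c:] q + h"]) simp
    qed
  qed
  then show ?thesis
    using that by blast
qed

text \<open>The only monomials of weight \<open>m \<ge> 0\<close> are \<open>z1 ^ m * (z1 * z2) ^ j\<close>, and those of weight
  \<open>- m\<close> are \<open>z2 ^ m * (z1 * z2) ^ i\<close>.\<close>

lemma eval2_weight_space_nonneg: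
  assumes "p \<in> weight_space {int m}"
  shows "\<exists>r. \<forall>x y. eval2 p x y = x ^ m * poly r (x * y)"
  using assms unfolding weight_space_def
proof (induction p rule: poly2.span_induct_alt)
  case base
  show ?case
    by (intro exI[of _ 0]) simp
next
  case (step c p q)
  then obtain i j where ij: "p = Z1 ^ i * Z2 ^ j" "int i - int j = int m"
    by blast
  then have "i = m + j"
    by linarith
  with ij have p: "p = Z1 ^ (m + j) * Z2 ^ j"
    by simp
  obtain r where r: "\<forall>x y. eval2 q x y = x ^ m * poly r (x * y)"
    using step.IH by blast
  show ?case
    by (intro exI[of _ "monom c j + r"])
      (simp add: p r eval2_Z1 eval2_Z2 poly_monom power_add power_mult_distrib algebra_simps)
qed

lemma eval2_weight_space_nonpos:
  assumes "p \<in> weight_space {- int m}"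
  shows "\<exists>r. \<forall>x y. eval2 p x y = y ^ m * poly r (x * y)"
  using assms unfolding weight_space_def
proof (induction p rule: poly2.span_induct_alt)
  case base
  show ?case
    by (intro exI[of _ 0]) simp
next
  case (step c p q)
  then obtain i j where ij: "p = Z1 ^ i * Z2 ^ j" "int i - int j = - int m"
    by blast
  then have "j = m + i"
    by linarith
  with ij have p: "p = Z1 ^ i * Z2 ^ (m + i)"
    by simp
  obtain r where r: "\<forall>x y. eval2 q x y = y ^ m * poly r (x * y)"
    using step.IH by blast
  show ?case
    by (intro exI[of _ "monom c i + r"])
      (simp add: p r eval2_Z1 eval2_Z2 poly_monom power_add power_mult_distrib algebra_simps)
qed


section \<open>Orthogonality in the weighted space\<close>

context holomorphic_rkhs
begin

text \<open>The factor \<open>f\<close> serves two cases: with the weight it gives orthogonality to spans of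
  orthogonal polynomials, and with \<open>f = 1\<close> orthogonality to spans of monomials.\<close>

lemma ip_pfun_span_left:
  assumes "p \<in> poly2.span A"
    and "\<And>q. q \<in> A \<Longrightarrow> ip (pfun \<Omega> (q * f)) (pfun \<Omega> u) = 0"
  shows "ip (pfun \<Omega> (p * f)) (pfun \<Omega> u) = 0"
  using assms(1)
proof (induction p rule: poly2.span_induct_alt)
  case base
  have "ip (\<lambda>z. 0 * pfun \<Omega> 0 z) (pfun \<Omega> u) = 0 * ip (pfun \<Omega> 0) (pfun \<Omega> u)"
    by (rule ip_scale) (rule polynomials_mem)+
  then show ?case
    by (simp add: pfun_simps(1))
next
  case (step c q p)
  have "ip (pfun \<Omega> ((smult [:c:] q + p) * f)) (pfun \<Omega> u)
      = ip (pfun \<Omega> (smult [:c:] (q * f) + p * f)) (pfun \<Omega> u)"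
    by (simp add: distrib_right)
  also have "\<dots> = ip (pfun \<Omega> (smult [:c:] (q * f))) (pfun \<Omega> u) + ip (pfun \<Omega> (p * f)) (pfun \<Omega> u)"
    unfolding pfun_simps(2) by (rule ip_add) (rule polynomials_mem)+
  also have "ip (pfun \<Omega> (smult [:c:] (q * f))) (pfun \<Omega> u) = c * ip (pfun \<Omega> (q * f)) (pfun \<Omega> u)"
    unfolding pfun_simps(4) by (rule ip_scale) (rule polynomials_mem)+
  finally show ?case
    using step.IH assms(2)[OF step.hyps(1)] by simp
qed

lemma ip_pfun_eq_0_commute:
  "ip (pfun \<Omega> p) (pfun \<Omega> q) = 0 \<longleftrightarrow> ip (pfun \<Omega> q) (pfun \<Omega> p) = 0"
  using ip_cnj[OF polynomials_mem[of p] polynomials_mem[of q]] by auto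

lemma ip_of_weight_disjoint:
  assumes "monomials_orthogonal \<Omega> ip" "p \<in> weight_space D" "q \<in> weight_space E" "D \<inter> E = {}"
  shows "ip (pfun \<Omega> p) (pfun \<Omega> q) = 0"
proof -
  define mons where "mons F = {Z1 ^ i * Z2 ^ j | i j. int i - int j \<in> F}" for F
  have p: "p \<in> poly2.span (mons D)" and q: "q \<in> poly2.span (mons E)"
    using assms(2,3) by (simp_all add: weight_space_def mons_def)
  have monomial: "ip (pfun \<Omega> u) (pfun \<Omega> v) = 0" if "u \<in> mons D" "v \<in> mons E" for u v
  proof -
    obtain i j where u: "u = Z1 ^ i * Z2 ^ j" "int i - int j \<in> D"
      using \<open>u \<in> mons D\<close> unfolding mons_def by blast
    obtain i' j' where v: "v = Z1 ^ i' * Z2 ^ j'" "int i' - int j' \<in> E"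
      using \<open>v \<in> mons E\<close> unfolding mons_def by blast
    have "(i, j) \<noteq> (i', j')"
      using u(2) v(2) \<open>D \<inter> E = {}\<close> by auto
    then show ?thesis
      using assms(1) unfolding u(1) v(1) monomials_orthogonal_def by blast
  qed
  have "ip (pfun \<Omega> p) (pfun \<Omega> v) = 0" if "v \<in> mons E" for v
    using ip_pfun_span_left[OF p, of 1 v] monomial that by simp
  then have "ip (pfun \<Omega> v) (pfun \<Omega> p) = 0" if "v \<in> mons E" for v
    using that ip_pfun_eq_0_commute by blast
  then have "ip (pfun \<Omega> q) (pfun \<Omega> p) = 0"
    using ip_pfun_span_left[OF q, of 1 p] by simp
  then show ?thesis
    using ip_pfun_eq_0_commute by blast
qed

lemma weighted_ip_pfun:
  "weighted_ip ip (pfun \<Omega> f) (pfun \<Omega> p) (pfun \<Omega> q) = ip (pfun \<Omega> (p * f)) (pfun \<Omega> (q * f))"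
  by (simp add: weighted_ip_def pfun_simps)

lemma weighted_ip_of_weight_disjoint:
  assumes "monomials_orthogonal \<Omega> ip" "p \<in> weight_space D" "q \<in> weight_space E" "D \<inter> E = {}"
    and "f = (\<Sum>k\<in>I. smult [:a k:] ((Z1 * Z2) ^ k))"
  shows "weighted_ip ip (pfun \<Omega> f) (pfun \<Omega> p) (pfun \<Omega> q) = 0"
  unfolding weighted_ip_pfun assms(5)
  using assms by (intro ip_of_weight_disjoint mult_poly_in_Z1_Z2_weight_space)

lemma weighted_ip_definite:
  assumes "weighted_ip ip (pfun \<Omega> f) (pfun \<Omega> p) (pfun \<Omega> p) = 0" "f \<noteq> 0"
  shows "p = 0"
proof -
  have "pfun \<Omega> (p * f) = (\<lambda>z. 0)"
    using assms(1) unfolding weighted_ip_pfun by (rule ip_definite[OF polynomials_mem])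
  then have "p * f = 0"
    using open_domain origin_in_domain by (intro pfun_eq_0_imp_eq_0) auto
  then show ?thesis
    using \<open>f \<noteq> 0\<close> by simp
qed

lemma orthogonal_poly_orthogonal_to_earlier:
  assumes "monic_orthogonal_polys \<Omega> ip f \<phi>" "h \<in> poly2.span (chi ` {..<N})"
  shows "weighted_ip ip (pfun \<Omega> f) (pfun \<Omega> h) (pfun \<Omega> (\<phi> N)) = 0"
proof -
  have "poly2.span (\<phi> ` {..<N}) = poly2.span (chi ` {..<N})"
    using assms(1)
    by (cases N) (simp_all add: monic_orthogonal_polys_def lessThan_Suc_atMost)
  then have "h \<in> poly2.span (\<phi> ` {..<N})"
    using assms(2) by simp
  then show ?thesis
    unfolding weighted_ip_pfun
  proof (rule ip_pfun_span_left)
    fix q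
    assume "q \<in> \<phi> ` {..<N}"
    then obtain k where "q = \<phi> k" "k \<noteq> N"
      by auto
    then show "ip (pfun \<Omega> (q * f)) (pfun \<Omega> (\<phi> N * f)) = 0"
      using assms(1) by (simp add: monic_orthogonal_polys_def flip: weighted_ip_pfun)
  qed
qed

text \<open>The part \<open>h\<close> of \<open>\<phi> N\<close> that has other weights is orthogonal to \<open>\<phi> N\<close>, because it has
  lower order, and to \<open>\<phi> N - h\<close>, because the weights differ.\<close>

lemma orthogonal_poly_weight_homogeneous:
  assumes "monomials_orthogonal \<Omega> ip"
    and f: "f = (\<Sum>k\<in>I. smult [:a k:] ((Z1 * Z2) ^ k))" "f \<noteq> 0"
    and "monic_orthogonal_polys \<Omega> ip f \<phi>"
  shows "\<phi> N \<in> weight_space {int (exp1 N) - int (exp2 N)}"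
proof -
  define d where "d = int (exp1 N) - int (exp2 N)"
  have "\<phi> N \<in> poly2.span (\<phi> ` {..N})"
    by (intro poly2.span_base) simp
  then have "\<phi> N \<in> poly2.span (chi ` {..N})"
    using assms(4) by (simp add: monic_orthogonal_polys_def)
  then obtain g h where gh: "\<phi> N = g + h" "g \<in> weight_space {d}" "h \<in> weight_space (- {d})"
    "h \<in> poly2.span (chi ` {..<N})"
    using d_def by (rule split_leading_weight)
  have "ip (pfun \<Omega> (\<phi> N * f)) (pfun \<Omega> (h * f)) = 0"
    using orthogonal_poly_orthogonal_to_earlier[OF assms(4) gh(4)]
    by (simp add: weighted_ip_pfun ip_pfun_eq_0_commute[of "\<phi> N * f"])
  moreover have "ip (pfun \<Omega> (g * f)) (pfun \<Omega> (h * f)) = 0"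
    using weighted_ip_of_weight_disjoint[OF assms(1) gh(2,3) _ f(1)]
    by (simp add: weighted_ip_pfun)
  moreover have "ip (pfun \<Omega> (\<phi> N * f)) (pfun \<Omega> (h * f))
      = ip (pfun \<Omega> (g * f)) (pfun \<Omega> (h * f)) + ip (pfun \<Omega> (h * f)) (pfun \<Omega> (h * f))"
    unfolding gh(1) distrib_right pfun_simps(2) by (rule ip_add) (rule polynomials_mem)+
  ultimately have "weighted_ip ip (pfun \<Omega> f) (pfun \<Omega> h) (pfun \<Omega> h) = 0"
    by (simp add: weighted_ip_pfun)
  then have "h = 0"
    using \<open>f \<noteq> 0\<close> by (rule weighted_ip_definite)
  then show ?thesis
    using gh(1,2) by (simp add: d_def)
qed

end


section \<open>Form of the orthogonal polynomials\<close>

theorem theorem18: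
  fixes \<Omega> :: "(complex \<times> complex) set"
    and H :: "(complex \<times> complex \<Rightarrow> complex) set"
    and ip :: "(complex \<times> complex \<Rightarrow> complex) \<Rightarrow> (complex \<times> complex \<Rightarrow> complex) \<Rightarrow> complex"
    and a :: "nat \<Rightarrow> complex" and K :: nat
    and f :: "complex poly poly" and \<phi> :: "nat \<Rightarrow> complex poly poly"
    and N M :: nat
  assumes rkhs: "holomorphic_rkhs \<Omega> H ip"
    and monomials: "monomials_orthogonal \<Omega> ip"
    and f_def: "f = (\<Sum>k=0..K. smult [:a k:] ((Z1 * Z2) ^ k))"
    and f_nonzero: "f \<noteq> 0"
    and orthogonal_polys: "monic_orthogonal_polys \<Omega> ip f \<phi>"
    and M_def: "M = max (deg1 (\<phi> N)) (deg2 (\<phi> N)) - min (deg1 (\<phi> N)) (deg2 (\<phi> N))"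
  shows "\<exists>!r :: complex poly.
    (deg1 (\<phi> N) \<ge> deg2 (\<phi> N) \<longrightarrow>
       (\<forall>z1 z2. eval2 (\<phi> N) z1 z2 = z1 ^ M * poly r (z1 * z2))) \<and>
    (deg1 (\<phi> N) \<le> deg2 (\<phi> N) \<longrightarrow>
       (\<forall>z1 z2. eval2 (\<phi> N) z1 z2 = z2 ^ M * poly r (z1 * z2)))"
proof -
  interpret holomorphic_rkhs \<Omega> H ip
    by (rule rkhs)
  have deg: "deg1 (\<phi> N) = exp1 N" "deg2 (\<phi> N) = exp2 N"
    using orthogonal_polys by (simp_all add: monic_orthogonal_polys_def deg1_chi deg2_chi)
  have homogeneous: "\<phi> N \<in> weight_space {int (exp1 N) - int (exp2 N)}"
    using monomials f_def f_nonzero orthogonal_polys by (rule orthogonal_poly_weight_homogeneous)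
  show ?thesis
  proof (cases "exp2 N \<le> exp1 N")
    case True
    then have "int (exp1 N) - int (exp2 N) = int M"
      by (simp add: M_def deg of_nat_diff)
    then obtain r where r: "\<forall>x y. eval2 (\<phi> N) x y = x ^ M * poly r (x * y)"
      using eval2_weight_space_nonneg homogeneous by metis
    show ?thesis
    proof (rule ex1I[of _ r])
      \<comment> \<open>If both degrees agree then \<open>M = 0\<close>, and the two required forms coincide.\<close>
      show "(deg1 (\<phi> N) \<ge> deg2 (\<phi> N) \<longrightarrow>
          (\<forall>z1 z2. eval2 (\<phi> N) z1 z2 = z1 ^ M * poly r (z1 * z2))) \<and>
        (deg1 (\<phi> N) \<le> deg2 (\<phi> N) \<longrightarrow>
          (\<forall>z1 z2. eval2 (\<phi> N) z1 z2 = z2 ^ M * poly r (z1 * z2)))"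
        using r True by (auto simp: M_def deg)
    next
      fix s
      assume "(deg1 (\<phi> N) \<ge> deg2 (\<phi> N) \<longrightarrow>
          (\<forall>z1 z2. eval2 (\<phi> N) z1 z2 = z1 ^ M * poly s (z1 * z2))) \<and>
        (deg1 (\<phi> N) \<le> deg2 (\<phi> N) \<longrightarrow>
          (\<forall>z1 z2. eval2 (\<phi> N) z1 z2 = z2 ^ M * poly s (z1 * z2)))"
      then have "eval2 (\<phi> N) 1 y = 1 ^ M * poly s (1 * y)" for y
        using True unfolding deg by blast
      then have "poly s y = poly r y" for y
        using r[rule_format, of 1 y] by simp
      then show "s = r"
        by (simp flip: poly_eq_poly_eq_iff add: fun_eq_iff)
    qed
  next
    case False
    then have "int (exp1 N) - int (exp2 N) = - int M"
      by (simp add: M_def deg of_nat_diff)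
    then obtain r where r: "\<forall>x y. eval2 (\<phi> N) x y = y ^ M * poly r (x * y)"
      using eval2_weight_space_nonpos homogeneous by metis
    show ?thesis
    proof (rule ex1I[of _ r])
      show "(deg1 (\<phi> N) \<ge> deg2 (\<phi> N) \<longrightarrow>
          (\<forall>z1 z2. eval2 (\<phi> N) z1 z2 = z1 ^ M * poly r (z1 * z2))) \<and>
        (deg1 (\<phi> N) \<le> deg2 (\<phi> N) \<longrightarrow>
          (\<forall>z1 z2. eval2 (\<phi> N) z1 z2 = z2 ^ M * poly r (z1 * z2)))"
        using r False by (simp add: deg)
    next
      fix s
      assume "(deg1 (\<phi> N) \<ge> deg2 (\<phi> N) \<longrightarrow>
          (\<forall>z1 z2. eval2 (\<phi> N) z1 z2 = z1 ^ M * poly s (z1 * z2))) \<and>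
        (deg1 (\<phi> N) \<le> deg2 (\<phi> N) \<longrightarrow>
          (\<forall>z1 z2. eval2 (\<phi> N) z1 z2 = z2 ^ M * poly s (z1 * z2)))"
      then have "eval2 (\<phi> N) x 1 = 1 ^ M * poly s (x * 1)" for x
        using False unfolding deg by (meson nle_le)
      then have "poly s x = poly r x" for x
        using r[rule_format, of x 1] by simp
      then show "s = r"
        by (simp flip: poly_eq_poly_eq_iff add: fun_eq_iff)
    qed
  qed
qed

end
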